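(* Suppose choices follow the Luce choice model with true parameter $\theta^\star\in\Theta_b$, all (fixed) comparison sets $S_1,\dots,S_m$ have cardinality $k\ge2$, and $\lambda_2(L_M)>0$. Let $\widehat\theta\in\arg\max_{\theta\in\Theta_b}\ell(\theta)$. Then with probability at least $1-2/n$, $$\mathrm{MSE}(\widehat\theta,\theta^\star)\le D^2\,\frac{n(\log n+2)}{\lambda_2(L_M)^2}\,\frac1m,\qquad D=4k^2e^{4b}.$$
   Context: Items $N=\{1,\dots,n\}$; observations $(S_t,y_t)$, $t=1,\dots,m$, $y_t\in S_t\subseteq N$. Luce choice model: given the comparison sets, the choices are independent with $\Pr[y_t=i]=p_{i,S_t}(\theta^\star)$, where $p_{i,S}(\theta)=e^{\theta_i}/\sum_{v\in S}e^{\theta_v}$. Log-likelihood $\ell(\theta)=\sum_{t=1}^m\log p_{y_t,S_t}(\theta)$. $\Theta_b=\{\theta\in[-b,b]^n:\sum_i\theta_i=0\}$, $\mathrm{MSE}(\widehat\theta,\theta^\star)=\frac1n\|\widehat\theta-\theta^\star\|_2^2$. $M\in\mathbb R^{n\times n}$ has zero diagonal and off-diagonal entries $\frac nm\cdot\#\{t:\{i,j\}\subseteq S_t\}$. Laplacian $L_A=\mathrm{diag}(A\mathbf 1)-A$; $\lambda_2$ is the second smallest eigenvalue. *)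

theory Defs
  imports "HOL-Probability.Probability" "Jordan_Normal_Form.Char_Poly"
begin

text \<open>Items are 0..<n, observations are indexed by t < m. Parameter vectors are
  functions nat => real, extensional (zero outside the item set).\<close>

definition luce_prob :: "(nat \<Rightarrow> real) \<Rightarrow> nat set \<Rightarrow> nat \<Rightarrow> real" where
  "luce_prob \<theta> S i = exp (\<theta> i) / (\<Sum>v\<in>S. exp (\<theta> v))"

definition luce_pmf :: "(nat \<Rightarrow> real) \<Rightarrow> nat set \<Rightarrow> nat pmf" where
  "luce_pmf \<theta> S = embed_pmf (\<lambda>i. if i \<in> S then luce_prob \<theta> S i else 0)"

definition choices_pmf :: "(nat \<Rightarrow> real) \<Rightarrow> nat \<Rightarrow> (nat \<Rightarrow> nat set) \<Rightarrow> (nat \<Rightarrow> nat) pmf" where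
  "choices_pmf \<theta> m S = Pi_pmf {..<m} 0 (\<lambda>t. luce_pmf \<theta> (S t))"

definition loglik :: "nat \<Rightarrow> (nat \<Rightarrow> nat set) \<Rightarrow> (nat \<Rightarrow> nat) \<Rightarrow> (nat \<Rightarrow> real) \<Rightarrow> real" where
  "loglik m S y \<theta> = (\<Sum>t<m. ln (luce_prob \<theta> (S t) (y t)))"

definition Theta :: "nat \<Rightarrow> real \<Rightarrow> (nat \<Rightarrow> real) set" where
  "Theta n b = {\<theta>. (\<forall>i<n. \<bar>\<theta> i\<bar> \<le> b) \<and> (\<forall>i\<ge>n. \<theta> i = 0) \<and> (\<Sum>i<n. \<theta> i) = 0}"

definition MSE :: "nat \<Rightarrow> (nat \<Rightarrow> real) \<Rightarrow> (nat \<Rightarrow> real) \<Rightarrow> real" where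
  "MSE n \<theta>1 \<theta>2 = (1 / real n) * (\<Sum>i<n. (\<theta>1 i - \<theta>2 i)^2)"

definition cooc_mat :: "nat \<Rightarrow> nat \<Rightarrow> (nat \<Rightarrow> nat set) \<Rightarrow> real mat" where
  "cooc_mat n m S = mat n n (\<lambda>(i,j). if i = j then 0
      else real n / real m * real (card {t. t < m \<and> {i, j} \<subseteq> S t}))"

definition laplacian :: "real mat \<Rightarrow> real mat" where
  "laplacian A = mat (dim_row A) (dim_col A)
      (\<lambda>(i,j). (if i = j then (\<Sum>l<dim_col A. A $$ (i,l)) else 0) - A $$ (i,j))"

definition lambda2 :: "real mat \<Rightarrow> real" where
  "lambda2 A = sorted_list_of_multiset (proots (char_poly A)) ! 1"

end

theory Submission
  imports Defs
begin

text \<open>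
  The score (the gradient of the log-likelihood at the true parameter) is a sum of independent
  centred random vectors of Euclidean norm at most \<open>sqrt 2\<close>. Since \<open>cosh (sqrt q)\<close> is convex in \<open>q\<close>,
  adding a centred vector of norm at most \<open>c\<close> multiplies the expectation of the \<open>cosh\<close> of the norm
  by at most \<open>cosh c\<close>; this yields a dimension-free sub-Gaussian tail bound for the norm of the score.

  On \<open>[-b, b]\<close> every choice probability is at least \<open>exp (-2b) / k\<close>, so a second-order Taylor expansion
  bounds the gain in log-likelihood by a linear term in the score minus a multiple of the Laplacian
  quadratic form of the error. The minimiser of the Rayleigh quotient of the Laplacian among vectors
  that sum to zero is an eigenvector. Its eigenvalue and the eigenvalue \<open>0\<close> of the constant vectors are
  two roots of the characteristic polynomial, counted with multiplicity. Hence the minimum is at least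
  \<open>lambda2\<close> when \<open>lambda2 > 0\<close>, and the quadratic form of the error dominates \<open>lambda2\<close> times its
  squared norm. As the gain of a maximiser is nonnegative, the norm of the error is bounded by a
  multiple of the norm of the score.
\<close>

unbundle no inner_syntax
unbundle no vec_syntax

section \<open>Tail bound for sums of independent centred vectors\<close>

lemma convex_on_nonneg_power: "convex_on {0..} (\<lambda>x::real. x ^ n)"
  using convex_on_subset[OF convex_power_even, of n "{0..}"] convex_power_odd[of n]
  by (cases "even n") auto

lemma cosh_sqrt_sums:
  assumes "q \<ge> (0::real)"
  shows "(\<lambda>j. q ^ j / fact (2 * j)) sums cosh (sqrt q)"
proof -
  let ?f = "\<lambda>n. if even n then sqrt q ^ n /\<^sub>R fact n else 0"
  have "?f n = 0" if "n \<notin> range ((*) 2)" for n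
    using that by (auto elim: evenE)
  then have "(\<lambda>j. ?f (2 * j)) sums cosh (sqrt q)"
    using sums_mono_reindex[of "(*) 2" ?f] cosh_converges[of "sqrt q"]
    by (simp only: strict_mono_def) simp
  moreover have "?f (2 * j) = q ^ j / fact (2 * j)" for j
  proof -
    have "sqrt q ^ (2 * j) = q ^ j" using assms by (simp only: power_mult real_sqrt_pow2)
    then show ?thesis by (simp add: divide_inverse_commute)
  qed
  ultimately show ?thesis by (simp only:)
qed

lemma convex_on_cosh_sqrt: "convex_on {0..} (\<lambda>q::real. cosh (sqrt q))"
proof (rule convex_onI)
  fix t x y :: real
  assume weight: "0 < t" "t < 1" and nonneg: "x \<in> {0..}" "y \<in> {0..}"
  let ?z = "(1 - t) *\<^sub>R x + t *\<^sub>R y"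
  have z_nonneg: "?z \<ge> 0" using weight nonneg by simp
  show "cosh (sqrt ?z) \<le> (1 - t) * cosh (sqrt x) + t * cosh (sqrt y)"
  proof (rule sums_le)
    show "(\<lambda>j. ?z ^ j / fact (2 * j)) sums cosh (sqrt ?z)"
      by (rule cosh_sqrt_sums[OF z_nonneg])
    show "(\<lambda>j. (1 - t) * (x ^ j / fact (2 * j)) + t * (y ^ j / fact (2 * j)))
            sums ((1 - t) * cosh (sqrt x) + t * cosh (sqrt y))"
      using nonneg by (intro sums_add sums_mult cosh_sqrt_sums) auto
    fix j
    have "?z ^ j \<le> (1 - t) * x ^ j + t * y ^ j"
      using convex_onD[OF convex_on_nonneg_power, of t x y j] weight nonneg by simp
    then have "?z ^ j / fact (2 * j) \<le> ((1 - t) * x ^ j + t * y ^ j) / fact (2 * j)"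
      by (intro divide_right_mono) auto
    then show "?z ^ j / fact (2 * j) \<le> (1 - t) * (x ^ j / fact (2 * j)) + t * (y ^ j / fact (2 * j))"
      by (simp add: add_divide_distrib)
  qed
qed simp

lemma two_power_mult_fact_le_fact_double: "(2::'a::linordered_semidom) ^ n * fact n \<le> fact (2 * n)"
proof (induction n)
  case (Suc n)
  have "(2::'a) ^ Suc n * fact (Suc n) = of_nat (2 * Suc n) * (2 ^ n * fact n)"
    by (simp only: power_Suc fact_Suc of_nat_mult of_nat_numeral mult_ac)
  also have "\<dots> \<le> of_nat (2 * Suc n) * (of_nat (2 * n + 1) * fact (2 * n))"
    using mult_mono[of 1 "of_nat (2 * n + 1)", OF _ Suc] by (intro mult_left_mono) simp_all
  also have "\<dots> = fact (2 * Suc n)" by (simp add: algebra_simps)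
  finally show ?case .
qed simp

lemma cosh_le_exp_half_square: "cosh x \<le> exp (x\<^sup>2 / 2)" for x :: real
proof (rule sums_le)
  show "(\<lambda>j. (x\<^sup>2) ^ j / fact (2 * j)) sums cosh x"
    using cosh_sqrt_sums[of "x\<^sup>2"] by simp
  show "(\<lambda>j. (x\<^sup>2 / 2) ^ j /\<^sub>R fact j) sums exp (x\<^sup>2 / 2)"
    by (rule exp_converges)
  fix j
  have "(x\<^sup>2) ^ j / fact (2 * j) \<le> (x\<^sup>2) ^ j / (2 ^ j * fact j)"
    by (intro divide_left_mono two_power_mult_fact_le_fact_double) simp_all
  then show "(x\<^sup>2) ^ j / fact (2 * j) \<le> (x\<^sup>2 / 2) ^ j /\<^sub>R fact j"
    by (simp add: power_divide field_simps)
qed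

text \<open>
  The chord of the convex function \<open>cosh (sqrt q)\<close> between \<open>(a - c)\<^sup>2\<close> and \<open>(a + c)\<^sup>2\<close>.
  For \<open>a * c = 0\<close> the quotient is \<open>0\<close>, and so is \<open>d\<close>.
\<close>

lemma cosh_sqrt_le_chord:
  fixes a c d :: real
  assumes nonneg: "0 \<le> a" "0 \<le> c" and abs_d_le: "\<bar>d\<bar> \<le> a * c"
  shows "cosh (sqrt (a\<^sup>2 + c\<^sup>2 + 2 * d)) \<le> cosh a * cosh c + sinh a * sinh c / (a * c) * d"
proof (cases "a * c = 0")
  case True
  then have "d = 0" using abs_d_le by (metis abs_le_zero_iff)
  then show ?thesis using True nonneg by auto
next
  case False
  then have "a * c > 0" using nonneg by (simp add: less_le)
  define t where "t = (1 + d / (a * c)) / 2"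
  have "\<bar>d / (a * c)\<bar> \<le> 1" using abs_d_le \<open>a * c > 0\<close> by simp
  then have weight: "0 \<le> t" "t \<le> 1" by (simp_all only: t_def abs_le_iff) simp_all
  have "a\<^sup>2 + c\<^sup>2 + 2 * d = (1 - t) * (a - c)\<^sup>2 + t * (a + c)\<^sup>2"
    using False by (simp add: t_def field_simps power2_eq_square)
  then have "cosh (sqrt (a\<^sup>2 + c\<^sup>2 + 2 * d))
      \<le> (1 - t) * cosh (sqrt ((a - c)\<^sup>2)) + t * cosh (sqrt ((a + c)\<^sup>2))"
    using convex_onD[OF convex_on_cosh_sqrt weight, of "(a - c)\<^sup>2" "(a + c)\<^sup>2"] by simp
  also have "\<dots> = (1 - t) * cosh (a - c) + t * cosh (a + c)" by simp
  also have "\<dots> = cosh a * cosh c + (2 * t - 1) * (sinh a * sinh c)"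
    by (simp add: cosh_add cosh_diff algebra_simps)
  also have "2 * t - 1 = d / (a * c)" by (simp add: t_def add_divide_distrib)
  finally show ?thesis by (simp add: mult_ac)
qed

lemma L2_set_power2: "(L2_set f I)\<^sup>2 = (\<Sum>i\<in>I. (f i)\<^sup>2)"
  by (simp add: L2_set_def sum_nonneg)

lemma abs_sum_mult_le_L2_set: "\<bar>\<Sum>i\<in>I. f i * g i\<bar> \<le> L2_set f I * L2_set g I"
proof -
  have "\<bar>\<Sum>i\<in>I. f i * g i\<bar> \<le> (\<Sum>i\<in>I. \<bar>f i\<bar> * \<bar>g i\<bar>)"
    by (rule order_trans[OF sum_abs]) (simp add: abs_mult)
  also have "\<dots> \<le> L2_set f I * L2_set g I" by (rule L2_set_mult_ineq)
  finally show ?thesis .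
qed

lemma cosh_L2_set_add_le:
  fixes x v :: "'i \<Rightarrow> real"
  assumes bounded: "L2_set v I \<le> c"
  defines "a \<equiv> L2_set x I"
  shows "cosh (L2_set (\<lambda>i. x i + v i) I)
           \<le> cosh a * cosh c + sinh a * sinh c / (a * c) * (\<Sum>i\<in>I. x i * v i)"
proof -
  define d where "d = (\<Sum>i\<in>I. x i * v i)"
  have nonneg: "0 \<le> a" "0 \<le> c"
    using order_trans[OF L2_set_nonneg bounded] by (simp_all add: a_def)
  have "\<bar>d\<bar> \<le> a * L2_set v I" unfolding d_def a_def by (rule abs_sum_mult_le_L2_set)
  also have "\<dots> \<le> a * c" using bounded nonneg by (intro mult_left_mono) auto
  finally have abs_d_le: "\<bar>d\<bar> \<le> a * c" .
  have "(L2_set (\<lambda>i. x i + v i) I)\<^sup>2 = a\<^sup>2 + (L2_set v I)\<^sup>2 + 2 * d"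
    unfolding a_def L2_set_power2 d_def
    by (simp add: power2_sum sum.distrib sum_distrib_left mult.assoc)
  also have "\<dots> \<le> a\<^sup>2 + c\<^sup>2 + 2 * d" using power_mono[OF bounded L2_set_nonneg, of 2] by simp
  finally have "L2_set (\<lambda>i. x i + v i) I \<le> sqrt (a\<^sup>2 + c\<^sup>2 + 2 * d)" by (rule real_le_rsqrt)
  then have "cosh (L2_set (\<lambda>i. x i + v i) I) \<le> cosh (sqrt (a\<^sup>2 + c\<^sup>2 + 2 * d))"
    by (intro iffD2[OF cosh_real_nonneg_le_iff] L2_set_nonneg order_trans[OF L2_set_nonneg])
  also have "\<dots> \<le> cosh a * cosh c + sinh a * sinh c / (a * c) * d"
    by (rule cosh_sqrt_le_chord[OF nonneg abs_d_le])
  finally show ?thesis by (simp add: d_def)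
qed

lemma nn_integral_cosh_L2_set_add_le:
  fixes x :: "'i \<Rightarrow> real" and \<xi> :: "'b \<Rightarrow> 'i \<Rightarrow> real"
  assumes "finite I"
    and bounded: "\<And>y. y \<in> set_pmf p \<Longrightarrow> L2_set (\<xi> y) I \<le> c"
    and centred: "\<And>i. i \<in> I \<Longrightarrow> measure_pmf.expectation p (\<lambda>y. \<xi> y i) = 0"
  shows "(\<integral>\<^sup>+y. ennreal (cosh (L2_set (\<lambda>i. x i + \<xi> y i) I)) \<partial>measure_pmf p)
           \<le> ennreal (cosh c * cosh (L2_set x I))"
proof -
  let ?a = "L2_set x I"
  define chord where
    "chord = (\<lambda>y. cosh ?a * cosh c + sinh ?a * sinh c / (?a * c) * (\<Sum>i\<in>I. x i * \<xi> y i))"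
  have cosh_le: "cosh (L2_set (\<lambda>i. x i + \<xi> y i) I) \<le> chord y" if "y \<in> set_pmf p" for y
    unfolding chord_def by (rule cosh_L2_set_add_le[OF bounded[OF that]])
  have integrable: "integrable (measure_pmf p) (\<lambda>y. \<xi> y i)" if "i \<in> I" for i
  proof (rule measure_pmf.integrable_const_bound)
    have "\<bar>\<xi> y i\<bar> \<le> L2_set (\<xi> y) I" for y
      using member_le_L2_set[OF \<open>finite I\<close> that, of "\<lambda>i. \<bar>\<xi> y i\<bar>"] by (simp add: L2_set_def)
    then show "AE y in measure_pmf p. norm (\<xi> y i) \<le> c"
      using bounded by (auto simp: AE_measure_pmf_iff intro: order_trans)
  qed simp
  then have "integrable (measure_pmf p) chord" by (simp add: chord_def)
  have "(\<integral>\<^sup>+y. ennreal (cosh (L2_set (\<lambda>i. x i + \<xi> y i) I)) \<partial>measure_pmf p)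
      \<le> (\<integral>\<^sup>+y. ennreal (chord y) \<partial>measure_pmf p)"
    by (intro nn_integral_mono_AE AE_pmfI ennreal_leI cosh_le)
  also have "\<dots> = ennreal (measure_pmf.expectation p chord)"
    using cosh_le \<open>integrable (measure_pmf p) chord\<close>
    by (intro nn_integral_eq_integral AE_pmfI) (auto intro: order_trans[OF cosh_real_nonneg])
  also have "measure_pmf.expectation p chord = cosh ?a * cosh c"
    using integrable by (simp add: chord_def Bochner_Integration.integral_sum centred)
  finally show ?thesis by (simp add: mult.commute)
qed

lemma nn_integral_Pi_pmf_insert:
  assumes "finite A" "s \<notin> A"
  shows "(\<integral>\<^sup>+y. f y \<partial>measure_pmf (Pi_pmf (insert s A) dflt p))
       = (\<integral>\<^sup>+z. \<integral>\<^sup>+y. f (y(s := z)) \<partial>measure_pmf (Pi_pmf A dflt p) \<partial>measure_pmf (p s))"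
  using assms by (simp add: Pi_pmf_insert nn_integral_pair_pmf')

lemma nn_integral_cosh_L2_set_sum_le:
  fixes x :: "'i \<Rightarrow> real" and \<xi> :: "'t \<Rightarrow> 'b \<Rightarrow> 'i \<Rightarrow> real"
  assumes "finite A" "finite I"
    and "\<And>t y. t \<in> A \<Longrightarrow> y \<in> set_pmf (p t) \<Longrightarrow> L2_set (\<xi> t y) I \<le> c"
    and "\<And>t i. t \<in> A \<Longrightarrow> i \<in> I \<Longrightarrow> measure_pmf.expectation (p t) (\<lambda>y. \<xi> t y i) = 0"
  shows "(\<integral>\<^sup>+y. ennreal (cosh (L2_set (\<lambda>i. x i + (\<Sum>t\<in>A. \<xi> t (y t) i)) I)) \<partial>measure_pmf (Pi_pmf A dflt p))
         \<le> ennreal (cosh c ^ card A * cosh (L2_set x I))"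
  using assms
proof (induction A arbitrary: x rule: finite_induct)
  case (insert s A)
  let ?F = "\<lambda>B x y. ennreal (cosh (L2_set (\<lambda>i. x i + (\<Sum>t\<in>B. \<xi> t (y t) i)) I))"
  have split_off: "?F (insert s A) x (y(s := z)) = ?F A (\<lambda>i. x i + \<xi> s z i) y" for y z
  proof -
    have "(\<Sum>t\<in>A. \<xi> t ((y(s := z)) t) i) = (\<Sum>t\<in>A. \<xi> t (y t) i)" for i
      using insert.hyps by (intro sum.cong) auto
    then show ?thesis using insert.hyps by (simp add: add.assoc)
  qed
  have "(\<integral>\<^sup>+y. ?F (insert s A) x y \<partial>measure_pmf (Pi_pmf (insert s A) dflt p))
      = (\<integral>\<^sup>+z. \<integral>\<^sup>+y. ?F A (\<lambda>i. x i + \<xi> s z i) y \<partial>measure_pmf (Pi_pmf A dflt p) \<partial>measure_pmf (p s))"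
    by (simp only: nn_integral_Pi_pmf_insert[OF insert.hyps(1,2)] split_off)
  also have "\<dots> \<le> (\<integral>\<^sup>+z. ennreal (cosh c ^ card A * cosh (L2_set (\<lambda>i. x i + \<xi> s z i) I)) \<partial>measure_pmf (p s))"
    using insert.prems by (intro nn_integral_mono insert.IH) auto
  also have "\<dots> = ennreal (cosh c ^ card A)
      * (\<integral>\<^sup>+z. ennreal (cosh (L2_set (\<lambda>i. x i + \<xi> s z i) I)) \<partial>measure_pmf (p s))"
    by (simp add: ennreal_mult nn_integral_cmult)
  also have "\<dots> \<le> ennreal (cosh c ^ card A) * ennreal (cosh c * cosh (L2_set x I))"
    using insert.prems by (intro mult_left_mono nn_integral_cosh_L2_set_add_le) auto
  finally show ?case using insert.hyps by (simp add: mult_ac flip: ennreal_mult)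
qed simp

lemma nn_integral_cosh_scaled_L2_set_sum_le:
  fixes \<xi> :: "'t \<Rightarrow> 'b \<Rightarrow> 'i \<Rightarrow> real" and l :: real
  assumes "finite A" "finite I"
    and "\<And>t y. t \<in> A \<Longrightarrow> y \<in> set_pmf (p t) \<Longrightarrow> L2_set (\<xi> t y) I \<le> c"
    and "\<And>t i. t \<in> A \<Longrightarrow> i \<in> I \<Longrightarrow> measure_pmf.expectation (p t) (\<lambda>y. \<xi> t y i) = 0"
    and "l \<ge> 0"
  shows "(\<integral>\<^sup>+y. ennreal (cosh (l * L2_set (\<lambda>i. \<Sum>t\<in>A. \<xi> t (y t) i) I)) \<partial>measure_pmf (Pi_pmf A dflt p))
           \<le> ennreal (exp (real (card A) * (l * c)\<^sup>2 / 2))"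
proof -
  let ?P = "measure_pmf (Pi_pmf A dflt p)"
  have scale: "L2_set (\<lambda>i. l * f i) I = l * L2_set f I" for f
    using \<open>l \<ge> 0\<close> by (simp add: L2_set_right_distrib)
  have "(\<integral>\<^sup>+y. ennreal (cosh (l * L2_set (\<lambda>i. \<Sum>t\<in>A. \<xi> t (y t) i) I)) \<partial>?P)
      = (\<integral>\<^sup>+y. ennreal (cosh (L2_set (\<lambda>i. 0 + (\<Sum>t\<in>A. l * \<xi> t (y t) i)) I)) \<partial>?P)"
    by (simp add: scale flip: sum_distrib_left)
  also have "\<dots> \<le> ennreal (cosh (l * c) ^ card A * cosh (L2_set (\<lambda>i. 0) I))"
    using assms by (intro nn_integral_cosh_L2_set_sum_le) (auto simp: scale intro!: mult_left_mono)
  also have "\<dots> \<le> ennreal (exp ((l * c)\<^sup>2 / 2) ^ card A)"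
    by (simp add: L2_set_def power_mono cosh_le_exp_half_square)
  also have "exp ((l * c)\<^sup>2 / 2) ^ card A = exp (real (card A) * (l * c)\<^sup>2 / 2)"
    by (simp flip: exp_of_nat_mult)
  finally show ?thesis .
qed

lemma prob_L2_set_sum_ge_le_exp:
  fixes \<xi> :: "'t \<Rightarrow> 'b \<Rightarrow> 'i \<Rightarrow> real" and l r :: real
  assumes "finite A" "finite I"
    and "\<And>t y. t \<in> A \<Longrightarrow> y \<in> set_pmf (p t) \<Longrightarrow> L2_set (\<xi> t y) I \<le> c"
    and "\<And>t i. t \<in> A \<Longrightarrow> i \<in> I \<Longrightarrow> measure_pmf.expectation (p t) (\<lambda>y. \<xi> t y i) = 0"
    and "l \<ge> 0"
  shows "measure_pmf.prob (Pi_pmf A dflt p) {y. L2_set (\<lambda>i. \<Sum>t\<in>A. \<xi> t (y t) i) I \<ge> r}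
           \<le> 2 * exp (real (card A) * (l * c)\<^sup>2 / 2 - l * r)"
proof -
  let ?P = "measure_pmf (Pi_pmf A dflt p)" and ?X = "\<lambda>y. L2_set (\<lambda>i. \<Sum>t\<in>A. \<xi> t (y t) i) I"
  have "indicator {y. ?X y \<ge> r} y \<le> ennreal (2 * exp (- (l * r))) * ennreal (cosh (l * ?X y))" for y
  proof (cases "?X y \<ge> r")
    case True
    then have "exp (l * r) \<le> exp (l * ?X y)" using \<open>l \<ge> 0\<close> by (simp add: mult_left_mono)
    also have "\<dots> \<le> 2 * cosh (l * ?X y)" by (simp add: cosh_field_def)
    finally have "1 \<le> 2 * exp (- (l * r)) * cosh (l * ?X y)" by (simp add: exp_minus field_simps)
    then show ?thesis using True by (simp flip: ennreal_mult)
  qed simp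
  then have "(\<integral>\<^sup>+y. indicator {y. ?X y \<ge> r} y \<partial>?P)
      \<le> (\<integral>\<^sup>+y. ennreal (2 * exp (- (l * r))) * ennreal (cosh (l * ?X y)) \<partial>?P)"
    by (intro nn_integral_mono)
  also have "\<dots> = ennreal (2 * exp (- (l * r))) * (\<integral>\<^sup>+y. ennreal (cosh (l * ?X y)) \<partial>?P)"
    by (simp add: nn_integral_cmult)
  also have "\<dots> \<le> ennreal (2 * exp (- (l * r))) * ennreal (exp (real (card A) * (l * c)\<^sup>2 / 2))"
    using assms by (intro mult_left_mono nn_integral_cosh_scaled_L2_set_sum_le) auto
  finally have "measure_pmf.prob (Pi_pmf A dflt p) {y. ?X y \<ge> r}
      \<le> 2 * exp (- (l * r)) * exp (real (card A) * (l * c)\<^sup>2 / 2)"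
    by (simp add: measure_pmf.emeasure_eq_measure flip: ennreal_mult)
  then show ?thesis by (simp add: mult.assoc flip: exp_add)
qed

lemma prob_L2_set_sum_gt_le:
  fixes \<xi> :: "'t \<Rightarrow> 'b \<Rightarrow> 'i \<Rightarrow> real" and c s :: real
  assumes "finite A" "finite I"
    and "\<And>t y. t \<in> A \<Longrightarrow> y \<in> set_pmf (p t) \<Longrightarrow> L2_set (\<xi> t y) I \<le> c"
    and "\<And>t i. t \<in> A \<Longrightarrow> i \<in> I \<Longrightarrow> measure_pmf.expectation (p t) (\<lambda>y. \<xi> t y i) = 0"
    and "c > 0" "s \<ge> 0"
  shows "measure_pmf.prob (Pi_pmf A dflt p)
           {y. L2_set (\<lambda>i. \<Sum>t\<in>A. \<xi> t (y t) i) I > c * sqrt (2 * real (card A) * s)} \<le> 2 * exp (- s)"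
proof (cases "A = {}")
  case True
  then show ?thesis by (simp add: L2_set_def)
next
  case False
  let ?P = "Pi_pmf A dflt p" and ?X = "\<lambda>y. L2_set (\<lambda>i. \<Sum>t\<in>A. \<xi> t (y t) i) I"
  define r where "r = c * sqrt (2 * real (card A) * s)"
  define l where "l = r / (c\<^sup>2 * real (card A))"
  have card_pos: "real (card A) > 0" using \<open>finite A\<close> False by (simp add: card_gt_0_iff)
  have "measure_pmf.prob ?P {y. ?X y > r} \<le> measure_pmf.prob ?P {y. ?X y \<ge> r}"
    by (intro measure_pmf.finite_measure_mono) auto
  also have "\<dots> \<le> 2 * exp (real (card A) * (l * c)\<^sup>2 / 2 - l * r)"
    using assms by (intro prob_L2_set_sum_ge_le_exp) (simp_all add: l_def r_def)
  also have "real (card A) * (l * c)\<^sup>2 / 2 - l * r = - (r\<^sup>2 / (2 * c\<^sup>2 * real (card A)))"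
    using card_pos \<open>c > 0\<close> by (simp add: l_def field_simps power2_eq_square)
  also have "r\<^sup>2 / (2 * c\<^sup>2 * real (card A)) = s"
    using card_pos \<open>c > 0\<close> \<open>s \<ge> 0\<close> by (simp add: r_def power_mult_distrib)
  finally show ?thesis by (simp only: r_def)
qed

section \<open>Rayleigh quotients and the second smallest eigenvalue\<close>

lemma sorted_list_of_multiset_nth_1_le:
  fixes M :: "'a::linorder multiset"
  assumes "{#x, y#} \<subseteq># M"
  shows "sorted_list_of_multiset M ! 1 \<le> max x y"
proof -
  obtain N where "M = add_mset x (add_mset y N)"
    using assms by (auto simp: mset_subset_eq_exists_conv)
  then have "sorted_list_of_multiset M = insort x (insort y (sorted_list_of_multiset N))"
    by simp
  moreover have "insort x (insort y zs) ! 1 \<le> max x y" for zs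
    by (cases zs; cases "tl zs") (auto simp: le_max_iff_disj)
  ultimately show ?thesis by simp
qed

lemma prod_dvd_det:
  fixes A :: "'a::comm_ring_1 mat"
  assumes carrier: "A \<in> carrier_mat n n"
    and dvd: "\<And>i j. i < n \<Longrightarrow> j < n \<Longrightarrow> f j dvd A $$ (i, j)"
  shows "(\<Prod>j<n. f j) dvd det A"
  unfolding det_col[OF carrier]
proof (rule dvd_sum)
  fix p assume "p \<in> {p. p permutes {0..<n}}"
  then have "p j < n" if "j < n" for j
    using that permutes_in_image[of p "{0..<n}" j] by auto
  then have "(\<Prod>j<n. f j) dvd (\<Prod>j<n. A $$ (p j, j))"
    by (intro prod_dvd_prod dvd) auto
  then show "(\<Prod>j<n. f j) dvd signof p * (\<Prod>j<n. A $$ (p j, j))" by (rule dvd_mult)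
qed

text \<open>Column \<open>j\<close> of \<open>(X - A) P\<close> is a multiple of \<open>X - \<mu> j\<close> for every \<open>j \<in> J\<close>.\<close>

lemma prod_eigenvalues_dvd_char_poly:
  fixes A P :: "'a::field mat"
  assumes A_carrier: "A \<in> carrier_mat n n" and P_carrier: "P \<in> carrier_mat n n"
    and det_P: "det P \<noteq> 0" and "J \<subseteq> {..<n}"
    and eigen: "\<And>j. j \<in> J \<Longrightarrow> A *\<^sub>v col P j = \<mu> j \<cdot>\<^sub>v col P j"
  shows "(\<Prod>j\<in>J. [:- \<mu> j, 1:]) dvd char_poly A"
proof -
  interpret const: comm_ring_hom "\<lambda>c::'a. [:c:]"
    by unfold_locales auto
  let ?P = "map_mat (\<lambda>c. [:c:]) P" and ?f = "\<lambda>j. if j \<in> J then [:- \<mu> j, 1:] else 1"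
  let ?N = "char_poly_matrix A * ?P"
  have carrier: "char_poly_matrix A \<in> carrier_mat n n" "?P \<in> carrier_mat n n" "A * P \<in> carrier_mat n n"
    using A_carrier P_carrier by auto
  have "char_poly_matrix A = [:0, 1:] \<cdot>\<^sub>m 1\<^sub>m n - map_mat (\<lambda>c. [:c:]) A"
    using A_carrier by (intro eq_matI) (auto simp: char_poly_matrix_def)
  then have "?N = ([:0, 1:] \<cdot>\<^sub>m 1\<^sub>m n) * ?P - map_mat (\<lambda>c. [:c:]) A * ?P"
    using A_carrier P_carrier by (simp add: minus_mult_distrib_mat[of _ n n])
  also have "\<dots> = [:0, 1:] \<cdot>\<^sub>m ?P - map_mat (\<lambda>c. [:c:]) (A * P)"
    using A_carrier P_carrier by (simp add: const.mat_hom_mult mult_smult_assoc_mat[of _ n n])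
  finally have N_eq: "?N = [:0, 1:] \<cdot>\<^sub>m ?P - map_mat (\<lambda>c. [:c:]) (A * P)" .
  have "?f j dvd ?N $$ (i, j)" if ij: "i < n" "j < n" for i j
  proof (cases "j \<in> J")
    case True
    have "(A * P) $$ (i, j) = (A *\<^sub>v col P j) $ i" using A_carrier P_carrier ij by simp
    also have "\<dots> = \<mu> j * P $$ (i, j)" using P_carrier ij by (simp add: eigen[OF True])
    finally have "?N $$ (i, j) = [:- \<mu> j, 1:] * [:P $$ (i, j):]"
      unfolding N_eq using A_carrier P_carrier ij by simp
    then show ?thesis using True by (simp only: if_True dvd_triv_left)
  qed simp
  then have "(\<Prod>j<n. ?f j) dvd det ?N"
    using carrier by (intro prod_dvd_det mult_carrier_mat)
  also have "(\<Prod>j<n. ?f j) = (\<Prod>j\<in>J. [:- \<mu> j, 1:])"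
    using \<open>J \<subseteq> {..<n}\<close> by (simp add: prod.If_cases Int_absorb1)
  also have "det ?N = Polynomial.smult (det P) (char_poly A)"
    using carrier by (simp add: det_mult char_poly_def const.hom_det)
  finally show ?thesis using det_P by (simp add: dvd_smult_iff)
qed

lemma replace_col_one_mult_vec:
  fixes u x :: "'a::comm_ring_1 vec"
  assumes "u \<in> carrier_vec n" "x \<in> carrier_vec n" "k < n" "i < n"
  shows "(replace_col (1\<^sub>m n) u k *\<^sub>v x) $ i = u $ i * x $ k + (if i = k then 0 else x $ i)"
proof -
  have "(replace_col (1\<^sub>m n) u k *\<^sub>v x) $ i
      = (\<Sum>j = 0..<n. (if j = k then u $ i else if i = j then 1 else 0) * x $ j)"
    using assms by (auto simp: replace_col_def scalar_prod_def intro!: sum.cong)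
  also have "\<dots> = (\<Sum>j = 0..<n. (if j = k then u $ i * x $ k else 0)
                      + (if j = i then if i = k then 0 else x $ i else 0))"
    by (intro sum.cong) auto
  finally show ?thesis using assms by (simp add: sum.distrib)
qed

lemma independent_vecs_extend_to_invertible_mat:
  fixes u w :: "'a::field vec"
  assumes carrier: "u \<in> carrier_vec n" "w \<in> carrier_vec n"
    and independent: "u \<noteq> 0\<^sub>v n" "\<And>c. w \<noteq> c \<cdot>\<^sub>v u"
  obtains P a b where "P \<in> carrier_mat n n" "det P \<noteq> 0" "a < n" "b < n" "a \<noteq> b"
    "col P a = u" "col P b = w"
proof -
  obtain a where a_nonzero: "a < n" "u $ a \<noteq> 0"
    using carrier independent(1) by (auto simp: vec_eq_iff)
  let ?c = "w $ a / u $ a"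
  obtain b where b_residual: "b < n" "w $ b \<noteq> ?c * u $ b"
    using independent(2)[of ?c] carrier by (auto simp: vec_eq_iff)
  have "a \<noteq> b" using a_nonzero b_residual by auto
  define Q where "Q = replace_col (1\<^sub>m n) u a"
  define x where "x = vec n (\<lambda>i. if i = a then ?c else w $ i - ?c * u $ i)"
  have Q_carrier: "Q \<in> carrier_mat n n" and x_carrier: "x \<in> carrier_vec n"
    by (simp_all add: Q_def x_def replace_col_def)
  have "det Q = u $ a"
    using cramer_lemma_mat[of "1\<^sub>m n" n u a] carrier a_nonzero by (simp add: Q_def)
  moreover have "Q *\<^sub>v x = w"
  proof (rule eq_vecI)
    show "(Q *\<^sub>v x) $ i = w $ i" if "i < dim_vec w" for i
      using that carrier a_nonzero x_carrier unfolding Q_def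
      by (subst replace_col_one_mult_vec) (auto simp: x_def)
  qed (use Q_carrier carrier in auto)
  ultimately have "det (replace_col Q w b) = x $ b * u $ a"
    using cramer_lemma_mat[OF Q_carrier x_carrier b_residual(1)] by simp
  also have "\<dots> \<noteq> 0" using a_nonzero b_residual \<open>a \<noteq> b\<close> by (simp add: x_def)
  finally have "det (replace_col Q w b) \<noteq> 0" .
  moreover have "replace_col Q w b \<in> carrier_mat n n"
    using Q_carrier by (simp add: replace_col_def)
  moreover have "col (replace_col Q w b) a = u" "col (replace_col Q w b) b = w"
    using carrier a_nonzero b_residual \<open>a \<noteq> b\<close> by (auto simp: Q_def replace_col_def)
  ultimately show thesis using that a_nonzero(1) b_residual(1) \<open>a \<noteq> b\<close> by blast
qed

lemma mult_eigenvalues_dvd_char_poly: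
  fixes A :: "'a::field mat"
  assumes A_carrier: "A \<in> carrier_mat n n"
    and eigen: "eigenvector A u \<alpha>" "eigenvector A w \<beta>"
    and independent: "\<And>c. w \<noteq> c \<cdot>\<^sub>v u"
  shows "[:- \<alpha>, 1:] * [:- \<beta>, 1:] dvd char_poly A"
proof -
  have "u \<in> carrier_vec n" "w \<in> carrier_vec n" "u \<noteq> 0\<^sub>v n"
    using eigen A_carrier by (auto simp: eigenvector_def)
  then obtain P a b where invertible: "P \<in> carrier_mat n n" "det P \<noteq> 0" and "a < n" "b < n" "a \<noteq> b"
    and cols: "col P a = u" "col P b = w"
    using independent_vecs_extend_to_invertible_mat[OF _ _ _ independent] by blast
  have "(\<Prod>j\<in>{a, b}. [:- (if j = a then \<alpha> else \<beta>), 1:]) dvd char_poly A"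
    using \<open>a < n\<close> \<open>b < n\<close> \<open>a \<noteq> b\<close> cols eigen
    by (intro prod_eigenvalues_dvd_char_poly[OF A_carrier invertible]) (auto simp: eigenvector_def)
  then show ?thesis using \<open>a \<noteq> b\<close> by simp
qed

lemma lambda2_le_max_eigenvalues:
  assumes A_carrier: "A \<in> carrier_mat n n"
    and eigen: "eigenvector A u \<alpha>" "eigenvector A w \<beta>"
    and independent: "\<And>c. w \<noteq> c \<cdot>\<^sub>v u"
  shows "lambda2 A \<le> max \<alpha> \<beta>"
proof -
  obtain r where char_poly_eq: "char_poly A = [:- \<alpha>, 1:] * [:- \<beta>, 1:] * r"
    using mult_eigenvalues_dvd_char_poly[OF A_carrier eigen independent] by (rule dvdE)
  have "char_poly A \<noteq> 0" using degree_monic_char_poly[OF A_carrier] by auto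
  then have "r \<noteq> 0" unfolding char_poly_eq by auto
  then have "proots (char_poly A) = {#\<alpha>#} + {#\<beta>#} + proots r"
    unfolding char_poly_eq by (subst proots_mult, simp, simp, subst proots_mult) simp_all
  then have "{#\<alpha>, \<beta>#} \<subseteq># proots (char_poly A)" by simp
  then show ?thesis unfolding lambda2_def by (rule sorted_list_of_multiset_nth_1_le)
qed

lemma quadratic_nonneg_imp_linear_coeff_eq_0:
  fixes a b :: real
  assumes "\<And>t. 0 \<le> a * t + b * t\<^sup>2"
  shows "a = 0"
proof (rule DERIV_local_min)
  show "((\<lambda>t. a * t + b * t\<^sup>2) has_real_derivative a) (at 0)"
    by (auto intro!: derivative_eq_intros)
  show "\<forall>t. \<bar>0 - t\<bar> < 1 \<longrightarrow> a * 0 + b * 0\<^sup>2 \<le> a * t + b * t\<^sup>2"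
    using assms by simp
qed simp

lemma psd_on_orthogonal_imp_kernel:
  fixes B :: "real mat"
  assumes B_carrier: "B \<in> carrier_mat n n" and symmetric: "transpose_mat B = B"
    and u_eigen: "u \<in> carrier_vec n" "B *\<^sub>v u = \<alpha> \<cdot>\<^sub>v u"
    and psd: "\<And>y. y \<in> carrier_vec n \<Longrightarrow> y \<bullet> u = 0 \<Longrightarrow> 0 \<le> y \<bullet> (B *\<^sub>v y)"
    and w_isotropic: "w \<in> carrier_vec n" "w \<bullet> u = 0" "w \<bullet> (B *\<^sub>v w) = 0"
  shows "B *\<^sub>v w = 0\<^sub>v n"
proof -
  define v where "v = B *\<^sub>v w"
  have v_carrier: "v \<in> carrier_vec n" using B_carrier w_isotropic by (simp add: v_def)
  have self_adjoint: "(B *\<^sub>v x) \<bullet> y = x \<bullet> (B *\<^sub>v y)"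
    if "x \<in> carrier_vec n" "y \<in> carrier_vec n" for x y
    using transpose_vec_mult_scalar[OF B_carrier that(2,1)] symmetric by simp
  have "v \<bullet> u = 0"
    using self_adjoint[OF w_isotropic(1) u_eigen(1)] u_eigen w_isotropic by (simp add: v_def)
  have "0 \<le> 2 * (v \<bullet> v) * t + (v \<bullet> (B *\<^sub>v v)) * t\<^sup>2" for t
  proof -
    define y where "y = w + t \<cdot>\<^sub>v v"
    have "B *\<^sub>v y = v + t \<cdot>\<^sub>v (B *\<^sub>v v)"
      using B_carrier w_isotropic v_carrier by (simp add: y_def v_def mult_add_distrib_mat_vec mult_mat_vec)
    then have "y \<bullet> (B *\<^sub>v y) = w \<bullet> v + t * (w \<bullet> (B *\<^sub>v v)) + t * (v \<bullet> v) + t\<^sup>2 * (v \<bullet> (B *\<^sub>v v))"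
      using B_carrier w_isotropic v_carrier
      by (simp add: y_def add_scalar_prod_distrib[of _ n] scalar_prod_add_distrib[of _ n]
          algebra_simps power2_eq_square)
    also have "w \<bullet> (B *\<^sub>v v) = v \<bullet> v" using self_adjoint[OF w_isotropic(1) v_carrier] by (simp add: v_def)
    also have "w \<bullet> v = 0" using w_isotropic by (simp add: v_def)
    finally have "y \<bullet> (B *\<^sub>v y) = 2 * (v \<bullet> v) * t + (v \<bullet> (B *\<^sub>v v)) * t\<^sup>2" by simp
    moreover have "y \<bullet> u = 0"
      using u_eigen w_isotropic v_carrier \<open>v \<bullet> u = 0\<close> by (simp add: y_def add_scalar_prod_distrib[of _ n])
    ultimately show ?thesis using psd[of y] w_isotropic v_carrier by (simp add: y_def)
  qed
  then have "2 * (v \<bullet> v) = 0" by (rule quadratic_nonneg_imp_linear_coeff_eq_0)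
  then show ?thesis using conjugate_square_eq_0_vec[OF v_carrier] by (simp add: v_def)
qed

lemma char_matrix_mult_vec:
  assumes "A \<in> carrier_mat n n" "v \<in> carrier_vec n"
  shows "char_matrix A e *\<^sub>v v = A *\<^sub>v v + (- e) \<cdot>\<^sub>v v"
proof (rule eq_vecI)
  fix i assume "i < dim_vec (A *\<^sub>v v + (- e) \<cdot>\<^sub>v v)"
  then have "i < n" using assms by simp
  then show "(char_matrix A e *\<^sub>v v) $ i = (A *\<^sub>v v + (- e) \<cdot>\<^sub>v v) $ i"
    using assms by (simp add: char_matrix_def add_scalar_prod_distrib[of _ n])
qed (use assms in \<open>simp add: char_matrix_def\<close>)

lemma transpose_char_matrix:
  assumes "A \<in> carrier_mat n n" "transpose_mat A = A"
  shows "transpose_mat (char_matrix A e) = char_matrix A e"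
proof -
  have "transpose_mat (- e \<cdot>\<^sub>m 1\<^sub>m n) = - e \<cdot>\<^sub>m 1\<^sub>m n" by (intro eq_matI) auto
  then show ?thesis using assms by (simp add: char_matrix_def transpose_add[of _ n n])
qed

lemma Rayleigh_quotient_minimizer_eigenvector:
  fixes A :: "real mat"
  assumes A_carrier: "A \<in> carrier_mat n n" and symmetric: "transpose_mat A = A"
    and u_eigen: "u \<in> carrier_vec n" "A *\<^sub>v u = \<alpha> \<cdot>\<^sub>v u"
    and w_attains: "w \<in> carrier_vec n" "w \<noteq> 0\<^sub>v n" "w \<bullet> u = 0" "w \<bullet> (A *\<^sub>v w) = \<mu> * (w \<bullet> w)"
    and minimal: "\<And>y. y \<in> carrier_vec n \<Longrightarrow> y \<bullet> u = 0 \<Longrightarrow> \<mu> * (y \<bullet> y) \<le> y \<bullet> (A *\<^sub>v y)"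
  shows "eigenvector A w \<mu>"
proof -
  let ?B = "char_matrix A \<mu>"
  have quad_form: "y \<bullet> (?B *\<^sub>v y) = y \<bullet> (A *\<^sub>v y) - \<mu> * (y \<bullet> y)" if "y \<in> carrier_vec n" for y
    using that A_carrier by (simp add: char_matrix_mult_vec[of _ n] scalar_prod_add_distrib[of _ n])
  have "?B *\<^sub>v w = 0\<^sub>v n"
  proof (rule psd_on_orthogonal_imp_kernel)
    show "?B \<in> carrier_mat n n" using A_carrier by simp
    show "transpose_mat ?B = ?B" by (rule transpose_char_matrix[OF A_carrier symmetric])
    show "?B *\<^sub>v u = (\<alpha> - \<mu>) \<cdot>\<^sub>v u"
      using char_matrix_mult_vec[OF A_carrier u_eigen(1), of \<mu>] add_smult_distrib_vec[of \<alpha> "- \<mu>" u] u_eigen(2)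
      by simp
    show "0 \<le> y \<bullet> (?B *\<^sub>v y)" if "y \<in> carrier_vec n" "y \<bullet> u = 0" for y
      using minimal[OF that] by (simp add: quad_form[OF that(1)])
    show "w \<bullet> (?B *\<^sub>v w) = 0" using w_attains(4) by (simp add: quad_form[OF w_attains(1)])
  qed (use u_eigen w_attains in auto)
  then show ?thesis using w_attains eigenvector_char_matrix[OF A_carrier] by blast
qed

lemma compact_sum_squares_eq_1:
  fixes I :: "'i set"
  assumes "finite I"
  shows "compact {f :: 'i \<Rightarrow> real. (\<forall>i. i \<notin> I \<longrightarrow> f i = 0) \<and> (\<Sum>i\<in>I. (f i)\<^sup>2) = 1}" (is "compact ?K")
proof -
  let ?cube = "\<Pi>\<^sub>E i\<in>UNIV. if i \<in> I then {-1..1::real} else {0}"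
  have "compactin (product_topology (\<lambda>i. euclidean) UNIV) ?cube"
    by (subst compactin_PiE) auto
  then have "compact ?cube"
    by (simp only: euclidean_product_topology compactin_euclidean_iff)
  moreover have "closed {f :: 'i \<Rightarrow> real. (\<Sum>i\<in>I. (f i)\<^sup>2) = 1}"
    by (intro closed_Collect_eq continuous_intros continuous_on_product_coordinates)
  ultimately have "compact (?cube \<inter> {f. (\<Sum>i\<in>I. (f i)\<^sup>2) = 1})" by (rule compact_Int_closed)
  moreover have "\<bar>f i\<bar> \<le> 1" if "(\<Sum>i\<in>I. (f i)\<^sup>2) = 1" "i \<in> I" for f :: "'i \<Rightarrow> real" and i
    using member_le_sum[of i I "\<lambda>i. (f i)\<^sup>2"] that assms by (simp add: abs_square_le_1)
  then have "?cube \<inter> {f. (\<Sum>i\<in>I. (f i)\<^sup>2) = 1} = ?K"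
    by (auto simp: PiE_def Pi_def abs_le_iff split: if_splits)
  ultimately show ?thesis by simp
qed

lemma scalar_prod_vec_self: "vec n f \<bullet> vec n f = (\<Sum>i<n. (f i)\<^sup>2)" for f :: "nat \<Rightarrow> real"
  by (simp add: scalar_prod_def power2_eq_square atLeast0LessThan)

text \<open>
  Unit vectors are represented by functions because these, unlike vectors of type \<open>real vec\<close>,
  carry a topology.
\<close>

definition orthogonal_unit_sphere :: "nat \<Rightarrow> real vec \<Rightarrow> (nat \<Rightarrow> real) set" where
  "orthogonal_unit_sphere n u =
     {f. (\<forall>i. i \<notin> {..<n} \<longrightarrow> f i = 0) \<and> (\<Sum>i<n. (f i)\<^sup>2) = 1} \<inter> {f. vec n f \<bullet> u = 0}"

lemma compact_orthogonal_unit_sphere: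
  assumes "u \<in> carrier_vec n"
  shows "compact (orthogonal_unit_sphere n u)"
proof -
  have "continuous_on UNIV (\<lambda>f. vec n f \<bullet> u)"
    using assms
    by (auto simp: scalar_prod_def intro!: continuous_intros continuous_on_product_coordinates)
  then show ?thesis
    unfolding orthogonal_unit_sphere_def
    by (intro compact_Int_closed compact_sum_squares_eq_1 closed_Collect_eq continuous_intros) auto
qed

lemma normalize_in_orthogonal_unit_sphere:
  assumes y_orthogonal: "y \<in> carrier_vec n" "y \<noteq> 0\<^sub>v n" "y \<bullet> u = 0" and u_carrier: "u \<in> carrier_vec n"
  obtains f where "f \<in> orthogonal_unit_sphere n u" "vec n f = (1 / sqrt (y \<bullet> y)) \<cdot>\<^sub>v y" "y \<bullet> y > 0"
proof -
  have pos: "y \<bullet> y > 0" using conjugate_square_greater_0_vec[OF y_orthogonal(1)] y_orthogonal by simp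
  define f where "f = (\<lambda>i. if i < n then y $ i / sqrt (y \<bullet> y) else 0)"
  have vec_f: "vec n f = (1 / sqrt (y \<bullet> y)) \<cdot>\<^sub>v y"
    using y_orthogonal by (intro eq_vecI) (auto simp: f_def)
  then have "vec n f \<bullet> vec n f = 1" "vec n f \<bullet> u = 0"
    using y_orthogonal u_carrier pos by (simp_all add: real_sqrt_mult_self divide_simps)
  then have "f \<in> orthogonal_unit_sphere n u"
    unfolding scalar_prod_vec_self by (simp add: orthogonal_unit_sphere_def f_def)
  then show thesis using that vec_f pos by blast
qed

lemma Rayleigh_quotient_minimizer_exists:
  fixes A :: "real mat"
  assumes A_carrier: "A \<in> carrier_mat n n" and u_carrier: "u \<in> carrier_vec n"
    and x_orthogonal: "x \<in> carrier_vec n" "x \<noteq> 0\<^sub>v n" "x \<bullet> u = 0"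
  obtains w \<mu> where "w \<in> carrier_vec n" "w \<noteq> 0\<^sub>v n" "w \<bullet> u = 0" "w \<bullet> (A *\<^sub>v w) = \<mu> * (w \<bullet> w)"
    and "\<And>y. y \<in> carrier_vec n \<Longrightarrow> y \<bullet> u = 0 \<Longrightarrow> \<mu> * (y \<bullet> y) \<le> y \<bullet> (A *\<^sub>v y)"
proof -
  let ?S = "orthogonal_unit_sphere n u" and ?q = "\<lambda>f. vec n f \<bullet> (A *\<^sub>v vec n f)"
  have "?S \<noteq> {}" using normalize_in_orthogonal_unit_sphere[OF x_orthogonal u_carrier] by blast
  moreover have "continuous_on UNIV ?q"
    using A_carrier
    by (auto simp: scalar_prod_def intro!: continuous_intros continuous_on_product_coordinates)
  then have "continuous_on ?S ?q" by (rule continuous_on_subset) simp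
  ultimately obtain f where f_in_sphere: "f \<in> ?S" and minimal: "\<And>g. g \<in> ?S \<Longrightarrow> ?q f \<le> ?q g"
    using continuous_attains_inf[OF compact_orthogonal_unit_sphere[OF u_carrier]] by blast
  have unit: "vec n f \<bullet> vec n f = 1" "vec n f \<bullet> u = 0"
    using f_in_sphere by (simp_all add: orthogonal_unit_sphere_def scalar_prod_vec_self)
  show thesis
  proof (rule that)
    show "vec n f \<noteq> 0\<^sub>v n"
      using unit(1) by (metis scalar_prod_left_zero zero_carrier_vec zero_neq_one)
    show "?q f = ?q f * (vec n f \<bullet> vec n f)" by (simp add: unit)
    show "?q f * (y \<bullet> y) \<le> y \<bullet> (A *\<^sub>v y)" if y_orthogonal: "y \<in> carrier_vec n" "y \<bullet> u = 0" for y
    proof (cases "y = 0\<^sub>v n")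
      case True
      then show ?thesis using A_carrier by simp
    next
      case False
      obtain g where "g \<in> ?S" and vec_g: "vec n g = (1 / sqrt (y \<bullet> y)) \<cdot>\<^sub>v y" and pos: "y \<bullet> y > 0"
        using normalize_in_orthogonal_unit_sphere[OF y_orthogonal(1) False y_orthogonal(2) u_carrier] by blast
      have "?q f \<le> ?q g" by (rule minimal[OF \<open>g \<in> ?S\<close>])
      also have "?q g = y \<bullet> (A *\<^sub>v y) / (y \<bullet> y)"
        using pos A_carrier y_orthogonal unfolding vec_g by (simp add: mult_mat_vec)
      finally show ?thesis using pos by (simp add: pos_le_divide_eq)
    qed
  qed (use unit in auto)
qed

lemma lambda2_le_Rayleigh_quotient:
  fixes A :: "real mat"
  assumes A_carrier: "A \<in> carrier_mat n n" and symmetric: "transpose_mat A = A"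
    and eigen: "eigenvector A u \<alpha>" "\<alpha> < lambda2 A"
    and x_orthogonal: "x \<in> carrier_vec n" "x \<bullet> u = 0"
  shows "lambda2 A * (x \<bullet> x) \<le> x \<bullet> (A *\<^sub>v x)"
proof (cases "x = 0\<^sub>v n")
  case True
  then show ?thesis using A_carrier by simp
next
  case False
  have u_eigen: "u \<in> carrier_vec n" "A *\<^sub>v u = \<alpha> \<cdot>\<^sub>v u"
    using eigen A_carrier by (auto simp: eigenvector_def)
  obtain w \<mu> where w_attains: "w \<in> carrier_vec n" "w \<noteq> 0\<^sub>v n" "w \<bullet> u = 0" "w \<bullet> (A *\<^sub>v w) = \<mu> * (w \<bullet> w)"
    and minimal: "\<And>y. y \<in> carrier_vec n \<Longrightarrow> y \<bullet> u = 0 \<Longrightarrow> \<mu> * (y \<bullet> y) \<le> y \<bullet> (A *\<^sub>v y)"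
    using Rayleigh_quotient_minimizer_exists[OF A_carrier u_eigen(1) x_orthogonal(1) False x_orthogonal(2)] by blast
  have "eigenvector A w \<mu>"
    by (rule Rayleigh_quotient_minimizer_eigenvector[OF A_carrier symmetric u_eigen w_attains minimal])
  moreover have "w \<noteq> c \<cdot>\<^sub>v u" for c
  proof
    assume "w = c \<cdot>\<^sub>v u"
    then have "w \<bullet> w = c * (w \<bullet> u)" using u_eigen w_attains by (metis scalar_prod_smult_distrib)
    then show False using w_attains(2,3) conjugate_square_eq_0_vec[OF w_attains(1)] by simp
  qed
  ultimately have "lambda2 A \<le> max \<alpha> \<mu>"
    by (rule lambda2_le_max_eigenvalues[OF A_carrier eigen(1)])
  then have "lambda2 A \<le> \<mu>" using eigen(2) by simp
  then have "lambda2 A * (x \<bullet> x) \<le> \<mu> * (x \<bullet> x)"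
    by (intro mult_right_mono) (auto simp: scalar_prod_def intro: sum_nonneg)
  also have "\<dots> \<le> x \<bullet> (A *\<^sub>v x)" by (rule minimal[OF x_orthogonal])
  finally show ?thesis .
qed

section \<open>The Laplacian of the co-occurrence matrix\<close>

definition pairwise_sq_diff :: "'a set \<Rightarrow> ('a \<Rightarrow> real) \<Rightarrow> real" where
  "pairwise_sq_diff S x = (\<Sum>u\<in>S. \<Sum>v\<in>S. (x u - x v)\<^sup>2)"

lemma pairwise_sq_diff_nonneg: "pairwise_sq_diff S x \<ge> 0"
  by (simp add: pairwise_sq_diff_def sum_nonneg)

lemma symmetric_mat_index:
  assumes "A \<in> carrier_mat n n" "transpose_mat A = A" "i < n" "j < n"
  shows "A $$ (j, i) = A $$ (i, j)"
  using assms by (metis carrier_matD index_transpose_mat(1))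

lemma laplacian_carrier_mat: "A \<in> carrier_mat n n \<Longrightarrow> laplacian A \<in> carrier_mat n n"
  by (auto simp: laplacian_def)

lemma transpose_laplacian:
  assumes "A \<in> carrier_mat n n" "transpose_mat A = A"
  shows "transpose_mat (laplacian A) = laplacian A"
proof (rule eq_matI)
  fix i j assume "i < dim_row (laplacian A)" "j < dim_col (laplacian A)"
  then have "i < n" "j < n" using assms(1) by (auto simp: laplacian_def)
  then show "transpose_mat (laplacian A) $$ (i, j) = laplacian A $$ (i, j)"
    using assms(1) symmetric_mat_index[OF assms] by (simp add: laplacian_def)
qed (use assms in \<open>auto simp: laplacian_def\<close>)

lemma laplacian_mult_vec:
  assumes "A \<in> carrier_mat n n" "i < n"
  shows "(laplacian A *\<^sub>v vec n x) $ i = (\<Sum>j<n. A $$ (i, j) * (x i - x j))"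
proof -
  have "(laplacian A *\<^sub>v vec n x) $ i
      = (\<Sum>j<n. (if j = i then (\<Sum>l<n. A $$ (i, l)) * x i else 0) - A $$ (i, j) * x j)"
    using assms
    by (auto simp: laplacian_def scalar_prod_def atLeast0LessThan algebra_simps intro!: sum.cong)
  also have "\<dots> = (\<Sum>j<n. A $$ (i, j) * (x i - x j))"
    using assms by (simp add: sum_subtractf sum_distrib_right right_diff_distrib)
  finally show ?thesis .
qed

lemma eigenvector_laplacian_one:
  assumes "A \<in> carrier_mat n n" "n > 0"
  shows "eigenvector (laplacian A) (vec n (\<lambda>_. 1)) 0"
  using assms laplacian_carrier_mat[OF assms(1)]
  by (auto simp: eigenvector_def vec_eq_iff laplacian_mult_vec simp del: index_mult_mat_vec)

lemma quad_form_laplacian: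
  assumes carrier: "A \<in> carrier_mat n n" and symmetric: "transpose_mat A = A"
  shows "vec n x \<bullet> (laplacian A *\<^sub>v vec n x) = (\<Sum>i<n. \<Sum>j<n. A $$ (i, j) * (x i - x j)\<^sup>2) / 2"
proof -
  let ?Q = "vec n x \<bullet> (laplacian A *\<^sub>v vec n x)"
  have Q_eq: "?Q = (\<Sum>i<n. \<Sum>j<n. A $$ (i, j) * (x i * (x i - x j)))"
    using carrier laplacian_carrier_mat[OF carrier]
    by (simp add: scalar_prod_def[of "vec n x"] atLeast0LessThan laplacian_mult_vec sum_distrib_left mult_ac
        del: index_mult_mat_vec)
  also have "\<dots> = (\<Sum>i<n. \<Sum>j<n. A $$ (i, j) * (x j * (x j - x i)))"
    by (subst sum.swap) (simp add: symmetric_mat_index[OF carrier symmetric])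
  finally have Q_eq_swapped: "?Q = \<dots>" .
  have "2 * ?Q = ?Q + ?Q" by simp
  also have "\<dots> = (\<Sum>i<n. \<Sum>j<n. A $$ (i, j) * (x i - x j)\<^sup>2)"
    by (subst (2) Q_eq_swapped, subst Q_eq)
      (simp add: power2_eq_square algebra_simps flip: sum.distrib)
  finally show ?thesis by simp
qed

lemma cooc_mat_carrier_mat: "cooc_mat n m S \<in> carrier_mat n n"
  by (simp add: cooc_mat_def)

lemma transpose_cooc_mat: "transpose_mat (cooc_mat n m S) = cooc_mat n m S"
  by (rule eq_matI) (auto simp: cooc_mat_def insert_commute)

lemma sum_cooc_mat_mult_sq_diff:
  fixes x :: "nat \<Rightarrow> real"
  assumes subset: "\<And>t. t < m \<Longrightarrow> S t \<subseteq> {..<n}"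
  shows "(\<Sum>i<n. \<Sum>j<n. cooc_mat n m S $$ (i, j) * (x i - x j)\<^sup>2)
       = real n / real m * (\<Sum>t<m. pairwise_sq_diff (S t) x)"
proof -
  have cooc_entry: "cooc_mat n m S $$ (i, j) * (x i - x j)\<^sup>2
      = real n / real m * (\<Sum>t<m. (x i - x j)\<^sup>2 * indicator (S t) j * indicator (S t) i)"
    if "i < n" "j < n" for i j
  proof -
    have "{t. t < m \<and> {i, j} \<subseteq> S t} = {..<m} \<inter> {t. j \<in> S t \<and> i \<in> S t}" by auto
    then have "real (card {t. t < m \<and> {i, j} \<subseteq> S t}) = (\<Sum>t<m. indicator (S t) j * indicator (S t) i)"
      by (simp add: indicator_def flip: of_bool_conj)
    moreover have "cooc_mat n m S $$ (i, j) * (x i - x j)\<^sup>2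
        = real n / real m * ((x i - x j)\<^sup>2 * real (card {t. t < m \<and> {i, j} \<subseteq> S t}))"
      using that by (simp add: cooc_mat_def)
    ultimately show ?thesis by (simp only: sum_distrib_left mult.assoc)
  qed
  have restrict: "(\<Sum>i<n. f i * indicator (S t) i) = (\<Sum>i\<in>S t. f i)"
    if "t < m" for t and f :: "nat \<Rightarrow> real"
    using subset[OF that] by (intro sum.mono_neutral_cong_right) auto
  have "(\<Sum>i<n. \<Sum>j<n. cooc_mat n m S $$ (i, j) * (x i - x j)\<^sup>2)
      = (\<Sum>i<n. \<Sum>j<n. real n / real m * (\<Sum>t<m. (x i - x j)\<^sup>2 * indicator (S t) j * indicator (S t) i))"
    by (intro sum.cong) (simp_all add: cooc_entry)
  also have "\<dots> = real n / real m *
      (\<Sum>t<m. \<Sum>i<n. (\<Sum>j<n. (x i - x j)\<^sup>2 * indicator (S t) j) * indicator (S t) i)"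
    by (simp only: sum.swap[of _ "{..<m}"] sum_distrib_left sum_distrib_right)
  also have "\<dots> = real n / real m * (\<Sum>t<m. pairwise_sq_diff (S t) x)"
    by (intro arg_cong[where f = "(*) (real n / real m)"] sum.cong refl)
      (simp only: lessThan_iff restrict pairwise_sq_diff_def)
  finally show ?thesis .
qed

lemma lambda2_laplacian_cooc_mat_le:
  fixes x :: "nat \<Rightarrow> real"
  assumes subset: "\<And>t. t < m \<Longrightarrow> S t \<subseteq> {..<n}"
    and lambda2_pos: "lambda2 (laplacian (cooc_mat n m S)) > 0"
    and sum_zero: "(\<Sum>i<n. x i) = 0"
  shows "lambda2 (laplacian (cooc_mat n m S)) * (\<Sum>i<n. (x i)\<^sup>2)
       \<le> real n / (2 * real m) * (\<Sum>t<m. pairwise_sq_diff (S t) x)"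
proof (cases "n = 0")
  case False
  let ?C = "cooc_mat n m S"
  have "lambda2 (laplacian ?C) * (vec n x \<bullet> vec n x) \<le> vec n x \<bullet> (laplacian ?C *\<^sub>v vec n x)"
  proof (rule lambda2_le_Rayleigh_quotient)
    show "eigenvector (laplacian ?C) (vec n (\<lambda>_. 1)) 0"
      using False by (intro eigenvector_laplacian_one cooc_mat_carrier_mat) simp
    show "vec n x \<bullet> vec n (\<lambda>_. 1) = 0"
      using sum_zero by (simp add: scalar_prod_def atLeast0LessThan)
  qed (use lambda2_pos in \<open>simp_all add: laplacian_carrier_mat transpose_laplacian[of _ n] transpose_cooc_mat
      cooc_mat_carrier_mat\<close>)
  also have "\<dots> = real n / (2 * real m) * (\<Sum>t<m. pairwise_sq_diff (S t) x)"
    by (simp add: quad_form_laplacian cooc_mat_carrier_mat transpose_cooc_mat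
        sum_cooc_mat_mult_sq_diff[OF subset])
  finally show ?thesis by (simp only: scalar_prod_vec_self)
qed simp

section \<open>The Luce choice model\<close>

lemma sum_luce_prob:
  assumes "finite S" "S \<noteq> {}"
  shows "(\<Sum>i\<in>S. luce_prob \<theta> S i) = 1"
proof -
  have "(\<Sum>v\<in>S. exp (\<theta> v)) > 0" using assms by (intro sum_pos) auto
  then show ?thesis by (simp add: luce_prob_def flip: sum_divide_distrib)
qed

lemma luce_prob_pos: "finite S \<Longrightarrow> S \<noteq> {} \<Longrightarrow> luce_prob \<theta> S i > 0"
  unfolding luce_prob_def by (intro divide_pos_pos sum_pos) auto

lemma luce_prob_le_1: "finite S \<Longrightarrow> i \<in> S \<Longrightarrow> luce_prob \<theta> S i \<le> 1"
  unfolding luce_prob_def by (intro divide_le_eq_1_pos[THEN iffD2] sum_pos member_le_sum) auto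

lemma luce_prob_ge:
  assumes "finite S" "i \<in> S" and bounded: "\<And>v. v \<in> S \<Longrightarrow> \<bar>\<theta> v\<bar> \<le> b"
  shows "exp (- 2 * b) / real (card S) \<le> luce_prob \<theta> S i"
proof -
  have "exp (- 2 * b) = exp (- b) / exp b" by (simp flip: exp_diff)
  then have "exp (- 2 * b) / real (card S) = exp (- b) / (real (card S) * exp b)" by simp
  also have "\<dots> \<le> exp (\<theta> i) / (\<Sum>v\<in>S. exp (\<theta> v))"
  proof (rule frac_le)
    show "exp (- b) \<le> exp (\<theta> i)" using bounded[OF \<open>i \<in> S\<close>] by simp
    show "(\<Sum>v\<in>S. exp (\<theta> v)) > 0" using assms by (intro sum_pos) auto
    show "(\<Sum>v\<in>S. exp (\<theta> v)) \<le> real (card S) * exp b"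
      using bounded by (intro sum_bounded_above) (simp add: abs_le_iff)
  qed simp
  finally show ?thesis by (simp add: luce_prob_def)
qed

definition log_sum_exp :: "nat set \<Rightarrow> (nat \<Rightarrow> real) \<Rightarrow> real" where
  "log_sum_exp S \<theta> = ln (\<Sum>v\<in>S. exp (\<theta> v))"

lemma ln_luce_prob:
  assumes "finite S" "S \<noteq> {}"
  shows "ln (luce_prob \<theta> S i) = \<theta> i - log_sum_exp S \<theta>"
proof -
  have "(\<Sum>v\<in>S. exp (\<theta> v)) > 0" using assms by (intro sum_pos) auto
  then show ?thesis by (simp add: luce_prob_def log_sum_exp_def ln_div)
qed

lemma variance_eq_sum_sq_diff:
  fixes p x :: "'a \<Rightarrow> real"
  assumes "(\<Sum>v\<in>S. p v) = 1"
  shows "(\<Sum>v\<in>S. p v * (x v)\<^sup>2) - (\<Sum>v\<in>S. p v * x v)\<^sup>2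
       = (\<Sum>u\<in>S. \<Sum>v\<in>S. p u * p v * (x u - x v)\<^sup>2) / 2"
proof -
  have "(\<Sum>u\<in>S. \<Sum>v\<in>S. p u * p v * (x u - x v)\<^sup>2)
      = (\<Sum>u\<in>S. \<Sum>v\<in>S. (p u * (x u)\<^sup>2) * p v + p u * (p v * (x v)\<^sup>2)
           - 2 * ((p u * x u) * (p v * x v)))"
    by (intro sum.cong) (auto simp: power2_eq_square algebra_simps)
  also have "\<dots> = (\<Sum>v\<in>S. p v * (x v)\<^sup>2) * (\<Sum>v\<in>S. p v) + (\<Sum>v\<in>S. p v) * (\<Sum>v\<in>S. p v * (x v)\<^sup>2)
      - 2 * ((\<Sum>v\<in>S. p v * x v) * (\<Sum>v\<in>S. p v * x v))"
    unfolding sum_product by (simp add: sum.distrib sum_subtractf sum_distrib_left)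
  finally show ?thesis using assms by (simp add: power2_eq_square)
qed

context
  fixes S :: "nat set" and \<theta> \<delta> :: "nat \<Rightarrow> real" and p :: "real \<Rightarrow> nat \<Rightarrow> real"
  assumes finite_nonempty: "finite S" "S \<noteq> {}"
  defines "p \<equiv> \<lambda>s. luce_prob (\<lambda>v. \<theta> v + s * \<delta> v) S"
begin

lemma has_real_derivative_log_sum_exp:
  "((\<lambda>s. log_sum_exp S (\<lambda>v. \<theta> v + s * \<delta> v)) has_real_derivative (\<Sum>v\<in>S. p s v * \<delta> v)) (at s)"
proof -
  have "(\<Sum>v\<in>S. exp (\<theta> v + s * \<delta> v)) > 0" using finite_nonempty by (intro sum_pos) auto
  then show ?thesis
    unfolding log_sum_exp_def p_def luce_prob_def
    by (auto intro!: derivative_eq_intros simp: sum_divide_distrib)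
qed

lemma has_real_derivative_luce_prob:
  "((\<lambda>s. p s i) has_real_derivative p s i * (\<delta> i - (\<Sum>v\<in>S. p s v * \<delta> v))) (at s)"
proof -
  have exp_form: "p s i = exp (\<theta> i + s * \<delta> i - log_sum_exp S (\<lambda>v. \<theta> v + s * \<delta> v))" for s i
    by (simp add: p_def luce_prob_pos[OF finite_nonempty]
        flip: ln_luce_prob[OF finite_nonempty, of "\<lambda>v. \<theta> v + s * \<delta> v" i])
  have "((\<lambda>s. exp (\<theta> i + s * \<delta> i - log_sum_exp S (\<lambda>v. \<theta> v + s * \<delta> v)))
      has_real_derivative p s i * (\<delta> i - (\<Sum>v\<in>S. p s v * \<delta> v))) (at s)"
    by (auto intro!: derivative_eq_intros has_real_derivative_log_sum_exp simp: exp_form)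
  then show ?thesis by (simp only: exp_form[symmetric])
qed

lemma has_real_derivative_sum_luce_prob_mult:
  "((\<lambda>s. \<Sum>v\<in>S. p s v * \<delta> v) has_real_derivative
     (\<Sum>u\<in>S. \<Sum>v\<in>S. p s u * p s v * (\<delta> u - \<delta> v)\<^sup>2) / 2) (at s)"
proof -
  let ?mean = "\<Sum>v\<in>S. p s v * \<delta> v"
  have "((\<lambda>s. \<Sum>v\<in>S. p s v * \<delta> v) has_real_derivative (\<Sum>v\<in>S. p s v * (\<delta> v - ?mean) * \<delta> v)) (at s)"
    by (intro DERIV_sum DERIV_cmult_right has_real_derivative_luce_prob)
  also have "(\<Sum>v\<in>S. p s v * (\<delta> v - ?mean) * \<delta> v) = (\<Sum>v\<in>S. p s v * (\<delta> v)\<^sup>2) - ?mean\<^sup>2"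
    by (simp add: power2_eq_square algebra_simps sum_subtractf sum_distrib_left)
  also have "\<dots> = (\<Sum>u\<in>S. \<Sum>v\<in>S. p s u * p s v * (\<delta> u - \<delta> v)\<^sup>2) / 2"
    by (rule variance_eq_sum_sq_diff) (simp add: p_def sum_luce_prob[OF finite_nonempty])
  finally show ?thesis .
qed

end

lemma second_order_Taylor_lower_bound:
  fixes f f' f'' :: "real \<Rightarrow> real"
  assumes "a < b"
    and deriv: "\<And>t. a \<le> t \<Longrightarrow> t \<le> b \<Longrightarrow> (f has_real_derivative f' t) (at t)"
    and second_deriv: "\<And>t. a \<le> t \<Longrightarrow> t \<le> b \<Longrightarrow> (f' has_real_derivative f'' t) (at t)"
    and second_deriv_ge: "\<And>t. a \<le> t \<Longrightarrow> t \<le> b \<Longrightarrow> c \<le> f'' t"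
  shows "f a + f' a * (b - a) + c / 2 * (b - a)\<^sup>2 \<le> f b"
proof -
  define D where "D = (\<lambda>i::nat. if i = 0 then f else if i = 1 then f' else f'')"
  have "\<exists>t>a. t < b \<and> f b = (\<Sum>i<2. D i a / fact i * (b - a) ^ i) + D 2 t / fact 2 * (b - a) ^ 2"
  proof (rule Taylor_up)
    show "\<forall>i t. i < 2 \<and> a \<le> t \<and> t \<le> b \<longrightarrow> DERIV (D i) t :> D (Suc i) t"
      using deriv second_deriv by (auto simp: D_def less_2_cases_iff)
  qed (use \<open>a < b\<close> in \<open>auto simp: D_def\<close>)
  then obtain t where t_between: "a < t" "t < b" and expansion:
    "f b = f a + f' a * (b - a) + f'' t / 2 * (b - a)\<^sup>2"
    by (auto simp: D_def numeral_2_eq_2)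
  have "c / 2 * (b - a)\<^sup>2 \<le> f'' t / 2 * (b - a)\<^sup>2"
    using second_deriv_ge[of t] t_between by (intro mult_right_mono) auto
  then show ?thesis unfolding expansion by simp
qed

lemma abs_add_scaled_le:
  fixes x d b s :: real
  assumes "0 \<le> s" "s \<le> 1" "\<bar>x\<bar> \<le> b" "\<bar>x + d\<bar> \<le> b"
  shows "\<bar>x + s * d\<bar> \<le> b"
proof -
  have "(1 - s) *\<^sub>R x + s *\<^sub>R (x + d) \<in> {- b..b}"
    using assms by (intro convexD_alt[OF convex_real_interval(5)]) auto
  moreover have "(1 - s) *\<^sub>R x + s *\<^sub>R (x + d) = x + s * d" by (simp add: algebra_simps)
  ultimately show ?thesis by auto
qed

lemma log_sum_exp_ge_quadratic:
  fixes \<theta> \<delta> :: "nat \<Rightarrow> real"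
  assumes finite_nonempty: "finite S" "S \<noteq> {}"
    and bounded: "\<And>v. v \<in> S \<Longrightarrow> \<bar>\<theta> v\<bar> \<le> b" "\<And>v. v \<in> S \<Longrightarrow> \<bar>\<theta> v + \<delta> v\<bar> \<le> b"
  shows "log_sum_exp S \<theta> + (\<Sum>v\<in>S. luce_prob \<theta> S v * \<delta> v)
           + exp (- 4 * b) / (4 * (real (card S))\<^sup>2) * pairwise_sq_diff S \<delta>
         \<le> log_sum_exp S (\<lambda>v. \<theta> v + \<delta> v)"
proof -
  let ?p = "\<lambda>s. luce_prob (\<lambda>v. \<theta> v + s * \<delta> v) S"
  let ?p_min = "exp (- 2 * b) / real (card S)"
  have curvature_ge:
    "?p_min\<^sup>2 * pairwise_sq_diff S \<delta> / 2 \<le> (\<Sum>u\<in>S. \<Sum>v\<in>S. ?p s u * ?p s v * (\<delta> u - \<delta> v)\<^sup>2) / 2"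
    if "0 \<le> s" "s \<le> 1" for s
  proof -
    have "?p_min \<le> ?p s v" if "v \<in> S" for v
      using that finite_nonempty bounded \<open>0 \<le> s\<close> \<open>s \<le> 1\<close> by (intro luce_prob_ge abs_add_scaled_le)
    then have "?p_min * ?p_min * (\<delta> u - \<delta> v)\<^sup>2 \<le> ?p s u * ?p s v * (\<delta> u - \<delta> v)\<^sup>2"
      if "u \<in> S" "v \<in> S" for u v
      using that luce_prob_pos[OF finite_nonempty]
      by (intro mult_right_mono mult_mono) (auto simp: less_imp_le)
    then show ?thesis
      unfolding pairwise_sq_diff_def power2_eq_square[of ?p_min] sum_distrib_left
      by (intro divide_right_mono sum_mono) auto
  qed
  have "log_sum_exp S (\<lambda>v. \<theta> v + 0 * \<delta> v) + (\<Sum>v\<in>S. ?p 0 v * \<delta> v) * (1 - 0)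
      + ?p_min\<^sup>2 * pairwise_sq_diff S \<delta> / 2 / 2 * (1 - 0)\<^sup>2 \<le> log_sum_exp S (\<lambda>v. \<theta> v + 1 * \<delta> v)"
    by (rule second_order_Taylor_lower_bound[OF _ has_real_derivative_log_sum_exp[OF finite_nonempty]
          has_real_derivative_sum_luce_prob_mult[OF finite_nonempty] curvature_ge]) simp_all
  moreover have "?p_min\<^sup>2 = exp (- 4 * b) / (real (card S))\<^sup>2"
    by (simp add: power_divide flip: exp_double)
  ultimately show ?thesis by simp
qed

lemma pmf_luce_pmf:
  assumes finite_nonempty: "finite S" "S \<noteq> {}"
  shows "pmf (luce_pmf \<theta> S) i = (if i \<in> S then luce_prob \<theta> S i else 0)"
  unfolding luce_pmf_def
proof (rule pmf_embed_pmf)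
  show "0 \<le> (if i \<in> S then luce_prob \<theta> S i else 0)" for i
    using luce_prob_pos[OF finite_nonempty, of \<theta> i] by simp
  have "(\<integral>\<^sup>+ i. ennreal (if i \<in> S then luce_prob \<theta> S i else 0) \<partial>count_space UNIV)
      = (\<Sum>i\<in>S. ennreal (luce_prob \<theta> S i))"
    using finite_nonempty by (subst nn_integral_count_space'[of S]) (auto intro!: sum.cong)
  also have "\<dots> = 1"
    using finite_nonempty luce_prob_pos[OF finite_nonempty] by (subst sum_ennreal) (auto simp: less_imp_le sum_luce_prob)
  finally show "(\<integral>\<^sup>+ i. ennreal (if i \<in> S then luce_prob \<theta> S i else 0) \<partial>count_space UNIV) = 1" .
qed

definition luce_score :: "(nat \<Rightarrow> real) \<Rightarrow> nat set \<Rightarrow> nat \<Rightarrow> nat \<Rightarrow> real" where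
  "luce_score \<theta> S y i = indicator {i} y - (if i \<in> S then luce_prob \<theta> S i else 0)"

lemma expectation_luce_score:
  assumes "finite S" "S \<noteq> {}"
  shows "measure_pmf.expectation (luce_pmf \<theta> S) (\<lambda>y. luce_score \<theta> S y i) = 0"
  unfolding luce_score_def using assms
  by (subst Bochner_Integration.integral_diff) (simp_all add: measure_pmf_single pmf_luce_pmf measure_pmf.emeasure_eq_measure)

lemma L2_set_luce_score_le:
  assumes "finite I" and S_subset: "S \<subseteq> I" "S \<noteq> {}"
  shows "L2_set (luce_score \<theta> S y) I \<le> sqrt 2"
proof -
  have "finite S" using assms finite_subset by blast
  have sq_le: "(luce_score \<theta> S y i)\<^sup>2 \<le> indicator {i} y + (if i \<in> S then luce_prob \<theta> S i else 0)" for i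
  proof -
    have "(indicator {i} y - q)\<^sup>2 \<le> indicator {i} y + q" if "0 \<le> q" "q \<le> 1" for q :: real
      using that mult_left_le[of q q] by (simp add: indicator_def power2_eq_square algebra_simps)
    then show ?thesis
      using luce_prob_pos[OF \<open>finite S\<close> S_subset(2)] luce_prob_le_1[OF \<open>finite S\<close>]
      by (simp add: luce_score_def less_imp_le)
  qed
  have "(\<Sum>i\<in>I. (luce_score \<theta> S y i)\<^sup>2)
      \<le> (\<Sum>i\<in>I. indicator {i} y + (if i \<in> S then luce_prob \<theta> S i else 0))"
    by (intro sum_mono sq_le)
  also have "\<dots> = (\<Sum>i\<in>I. indicator {i} y) + (\<Sum>i\<in>S. luce_prob \<theta> S i)"
    using \<open>finite I\<close> S_subset by (simp add: sum.distrib sum.If_cases Int_absorb1)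
  also have "\<dots> \<le> 2"
    using \<open>finite I\<close> sum_luce_prob[OF \<open>finite S\<close> S_subset(2), of \<theta>] card_mono[of "{y}" "I \<inter> {y}"]
    by (simp add: indicator_def)
  finally show ?thesis by (simp add: L2_set_def)
qed

lemma sum_luce_score_mult:
  assumes "finite I" "S \<subseteq> I" and "y \<notin> I \<Longrightarrow> \<delta> y = 0"
  shows "(\<Sum>i\<in>I. luce_score \<theta> S y i * \<delta> i) = \<delta> y - (\<Sum>i\<in>S. luce_prob \<theta> S i * \<delta> i)"
proof -
  have "(\<Sum>i\<in>I. luce_score \<theta> S y i * \<delta> i)
      = (\<Sum>i\<in>I. if i = y then \<delta> y else 0) - (\<Sum>i\<in>I. if i \<in> S then luce_prob \<theta> S i * \<delta> i else 0)"
    unfolding sum_subtractf[symmetric]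
    by (intro sum.cong) (auto simp: luce_score_def algebra_simps)
  also have "\<dots> = \<delta> y - (\<Sum>i\<in>S. luce_prob \<theta> S i * \<delta> i)"
    using assms by (simp add: sum.If_cases Int_absorb1)
  finally show ?thesis .
qed

lemma ln_luce_prob_diff_le:
  fixes \<theta> \<theta>' :: "nat \<Rightarrow> real"
  assumes "finite I" "S \<subseteq> I" "S \<noteq> {}" and "y \<notin> I \<Longrightarrow> \<theta>' y = \<theta> y"
    and bounded: "\<And>v. v \<in> S \<Longrightarrow> \<bar>\<theta> v\<bar> \<le> b" "\<And>v. v \<in> S \<Longrightarrow> \<bar>\<theta>' v\<bar> \<le> b"
  defines "\<delta> \<equiv> \<lambda>i. \<theta>' i - \<theta> i"
  shows "ln (luce_prob \<theta>' S y) - ln (luce_prob \<theta> S y)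
     \<le> (\<Sum>i\<in>I. luce_score \<theta> S y i * \<delta> i) - exp (- 4 * b) / (4 * (real (card S))\<^sup>2) * pairwise_sq_diff S \<delta>"
proof -
  have "finite S" using assms(1,2) finite_subset by blast
  have "log_sum_exp S \<theta> + (\<Sum>v\<in>S. luce_prob \<theta> S v * \<delta> v)
      + exp (- 4 * b) / (4 * (real (card S))\<^sup>2) * pairwise_sq_diff S \<delta> \<le> log_sum_exp S (\<lambda>v. \<theta> v + \<delta> v)"
    using bounded by (intro log_sum_exp_ge_quadratic \<open>finite S\<close> \<open>S \<noteq> {}\<close>) (auto simp: \<delta>_def)
  moreover have "(\<Sum>i\<in>I. luce_score \<theta> S y i * \<delta> i) = \<delta> y - (\<Sum>i\<in>S. luce_prob \<theta> S i * \<delta> i)"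
    using assms(1,2,4) by (intro sum_luce_score_mult) (auto simp: \<delta>_def)
  ultimately show ?thesis by (simp add: ln_luce_prob[OF \<open>finite S\<close> \<open>S \<noteq> {}\<close>] \<delta>_def)
qed

definition loglik_score :: "nat \<Rightarrow> (nat \<Rightarrow> nat set) \<Rightarrow> (nat \<Rightarrow> nat) \<Rightarrow> (nat \<Rightarrow> real) \<Rightarrow> nat \<Rightarrow> real" where
  "loglik_score m S y \<theta> = (\<lambda>i. \<Sum>t<m. luce_score \<theta> (S t) (y t) i)"

lemma prob_loglik_score_gt_le:
  assumes sets: "\<And>t. t < m \<Longrightarrow> S t \<subseteq> {..<n} \<and> S t \<noteq> {}" and "s \<ge> 0"
  shows "measure_pmf.prob (choices_pmf \<theta> m S)
           {y. L2_set (loglik_score m S y \<theta>) {..<n} > 2 * sqrt (real m * s)} \<le> 2 * exp (- s)"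
proof -
  have "finite (S t)" if "t < m" for t using sets[OF that] finite_subset by blast
  then have "measure_pmf.prob (choices_pmf \<theta> m S)
      {y. L2_set (\<lambda>i. \<Sum>t<m. luce_score \<theta> (S t) (y t) i) {..<n} > sqrt 2 * sqrt (2 * real (card {..<m}) * s)}
      \<le> 2 * exp (- s)"
    unfolding choices_pmf_def using sets \<open>s \<ge> 0\<close>
    by (intro prob_L2_set_sum_gt_le L2_set_luce_score_le expectation_luce_score) auto
  also have "sqrt 2 * sqrt (2 * real (card {..<m}) * s) = 2 * sqrt (real m * s)"
    by (simp add: real_sqrt_mult)
  finally show ?thesis by (simp only: loglik_score_def)
qed

lemma loglik_diff_le:
  assumes Theta: "\<theta> \<in> Theta n b" "\<theta>' \<in> Theta n b"
    and sets: "\<And>t. t < m \<Longrightarrow> S t \<subseteq> {..<n} \<and> S t \<noteq> {} \<and> card (S t) \<le> k"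
  defines "\<delta> \<equiv> \<lambda>i. \<theta>' i - \<theta> i"
  shows "loglik m S y \<theta>' - loglik m S y \<theta>
     \<le> (\<Sum>i<n. loglik_score m S y \<theta> i * \<delta> i)
       - exp (- 4 * b) / (4 * (real k)\<^sup>2) * (\<Sum>t<m. pairwise_sq_diff (S t) \<delta>)"
proof -
  let ?curvature = "\<lambda>j::nat. exp (- 4 * b) / (4 * (real j)\<^sup>2)"
  have summand_le: "ln (luce_prob \<theta>' (S t) (y t)) - ln (luce_prob \<theta> (S t) (y t))
     \<le> (\<Sum>i<n. luce_score \<theta> (S t) (y t) i * \<delta> i) - ?curvature k * pairwise_sq_diff (S t) \<delta>" if "t < m" for t
  proof -
    have "S t \<subseteq> {..<n}" "S t \<noteq> {}" using sets[OF that] by auto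
    then have "ln (luce_prob \<theta>' (S t) (y t)) - ln (luce_prob \<theta> (S t) (y t))
        \<le> (\<Sum>i<n. luce_score \<theta> (S t) (y t) i * \<delta> i) - ?curvature (card (S t)) * pairwise_sq_diff (S t) \<delta>"
      unfolding \<delta>_def using Theta by (intro ln_luce_prob_diff_le) (auto simp: Theta_def)
    moreover have "card (S t) > 0"
      using \<open>S t \<subseteq> {..<n}\<close> \<open>S t \<noteq> {}\<close> finite_subset by (auto simp: card_gt_0_iff)
    then have "?curvature k * pairwise_sq_diff (S t) \<delta> \<le> ?curvature (card (S t)) * pairwise_sq_diff (S t) \<delta>"
      using sets[OF that] by (intro mult_right_mono frac_le pairwise_sq_diff_nonneg) (auto intro: power_mono)
    ultimately show ?thesis by linarith
  qed
  have "loglik m S y \<theta>' - loglik m S y \<theta>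
      \<le> (\<Sum>t<m. (\<Sum>i<n. luce_score \<theta> (S t) (y t) i * \<delta> i) - ?curvature k * pairwise_sq_diff (S t) \<delta>)"
    unfolding loglik_def sum_subtractf[symmetric] using summand_le by (intro sum_mono) auto
  also have "\<dots> = (\<Sum>t<m. \<Sum>i<n. luce_score \<theta> (S t) (y t) i * \<delta> i)
      - ?curvature k * (\<Sum>t<m. pairwise_sq_diff (S t) \<delta>)"
    by (simp only: sum_subtractf sum_distrib_left)
  also have "(\<Sum>t<m. \<Sum>i<n. luce_score \<theta> (S t) (y t) i * \<delta> i) = (\<Sum>i<n. loglik_score m S y \<theta> i * \<delta> i)"
    by (subst sum.swap) (simp add: loglik_score_def sum_distrib_right)
  finally show ?thesis .
qed

lemma sum_pairwise_sq_diff_le: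
  assumes Theta: "\<theta> \<in> Theta n b" "\<theta>' \<in> Theta n b"
    and sets: "\<And>t. t < m \<Longrightarrow> S t \<subseteq> {..<n} \<and> S t \<noteq> {} \<and> card (S t) \<le> k" and "k > 0"
    and loglik_le: "loglik m S y \<theta> \<le> loglik m S y \<theta>'"
  shows "(\<Sum>t<m. pairwise_sq_diff (S t) (\<lambda>i. \<theta>' i - \<theta> i))
       \<le> 4 * (real k)\<^sup>2 * exp (4 * b)
           * (L2_set (loglik_score m S y \<theta>) {..<n} * L2_set (\<lambda>i. \<theta>' i - \<theta> i) {..<n})"
    (is "?W \<le> ?D * (?score * ?error)")
proof -
  have "0 \<le> loglik m S y \<theta>' - loglik m S y \<theta>" using loglik_le by simp
  also have "\<dots> \<le> (\<Sum>i<n. loglik_score m S y \<theta> i * (\<theta>' i - \<theta> i)) - exp (- 4 * b) / (4 * (real k)\<^sup>2) * ?W"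
    using Theta sets by (rule loglik_diff_le)
  also have "exp (- 4 * b) / (4 * (real k)\<^sup>2) = 1 / ?D"
    by (simp add: exp_minus field_simps)
  also have "(\<Sum>i<n. loglik_score m S y \<theta> i * (\<theta>' i - \<theta> i)) \<le> ?score * ?error"
    by (rule order_trans[OF abs_ge_self abs_sum_mult_le_L2_set])
  finally have "?W / ?D \<le> ?score * ?error" by simp
  moreover have "?D > 0" using \<open>k > 0\<close> by simp
  ultimately show ?thesis by (simp only: pos_divide_le_eq mult.commute)
qed

lemma lambda2_mult_L2_set_diff_le:
  assumes Theta: "\<theta> \<in> Theta n b" "\<theta>' \<in> Theta n b"
    and sets: "\<And>t. t < m \<Longrightarrow> S t \<subseteq> {..<n} \<and> S t \<noteq> {} \<and> card (S t) \<le> k" and "k > 0"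
    and lambda2_pos: "lambda2 (laplacian (cooc_mat n m S)) > 0"
    and loglik_le: "loglik m S y \<theta> \<le> loglik m S y \<theta>'"
  shows "lambda2 (laplacian (cooc_mat n m S)) * L2_set (\<lambda>i. \<theta>' i - \<theta> i) {..<n}
       \<le> 4 * (real k)\<^sup>2 * exp (4 * b) * (real n / (2 * real m)) * L2_set (loglik_score m S y \<theta>) {..<n}"
    (is "?lam * ?error \<le> ?D * ?ratio * ?score")
proof (cases "?error = 0")
  case True
  then show ?thesis by simp
next
  case False
  then have error_pos: "?error > 0" using L2_set_nonneg[of _ "{..<n}"] by (simp add: less_le)
  have "(\<Sum>i<n. \<theta>' i - \<theta> i) = 0" using Theta by (simp add: Theta_def sum_subtractf)
  then have "?lam * ?error\<^sup>2 \<le> ?ratio * (\<Sum>t<m. pairwise_sq_diff (S t) (\<lambda>i. \<theta>' i - \<theta> i))"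
    unfolding L2_set_power2 using lambda2_pos sets by (intro lambda2_laplacian_cooc_mat_le) auto
  also have "\<dots> \<le> ?ratio * (?D * (?score * ?error))"
    using Theta sets \<open>k > 0\<close> loglik_le by (intro mult_left_mono sum_pairwise_sq_diff_le) auto
  finally have "?lam * ?error * ?error \<le> ?D * ?ratio * ?score * ?error"
    by (simp add: power2_eq_square mult_ac)
  then show ?thesis using error_pos by (rule mult_right_le_imp_le)
qed

lemma MSE_eq_L2_set: "MSE n \<theta> \<theta>' = (L2_set (\<lambda>i. \<theta> i - \<theta>' i) {..<n})\<^sup>2 / real n"
  by (simp add: MSE_def L2_set_power2)

lemma MSE_le_of_loglik_score_le:
  assumes Theta: "\<theta> \<in> Theta n b" "\<theta>' \<in> Theta n b"
    and sets: "\<And>t. t < m \<Longrightarrow> S t \<subseteq> {..<n} \<and> S t \<noteq> {} \<and> card (S t) \<le> k" and "k > 0"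
    and lambda2_pos: "lambda2 (laplacian (cooc_mat n m S)) > 0"
    and loglik_le: "loglik m S y \<theta> \<le> loglik m S y \<theta>'"
    and score_le: "L2_set (loglik_score m S y \<theta>) {..<n} \<le> 2 * sqrt (real m * s)" and "s \<ge> 0"
  shows "MSE n \<theta>' \<theta> \<le> (4 * (real k)\<^sup>2 * exp (4 * b))\<^sup>2
           * (real n * s / (lambda2 (laplacian (cooc_mat n m S)))\<^sup>2) * (1 / real m)"
    (is "_ \<le> ?D\<^sup>2 * (_ / ?lam\<^sup>2) * _")
proof -
  let ?error = "L2_set (\<lambda>i. \<theta>' i - \<theta> i) {..<n}"
  have "?lam * ?error \<le> ?D * (real n / (2 * real m)) * L2_set (loglik_score m S y \<theta>) {..<n}"
    using Theta sets \<open>k > 0\<close> lambda2_pos loglik_le by (rule lambda2_mult_L2_set_diff_le)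
  also have "\<dots> \<le> ?D * (real n / (2 * real m)) * (2 * sqrt (real m * s))"
    using score_le by (intro mult_left_mono) auto
  finally have "?error * ?lam \<le> ?D * (real n / real m) * sqrt (real m * s)" by (simp add: mult_ac)
  then have "?error \<le> ?D * (real n / real m) * sqrt (real m * s) / ?lam"
    by (rule pos_le_divide_eq[THEN iffD2, OF lambda2_pos])
  then have "?error\<^sup>2 \<le> (?D * (real n / real m) * sqrt (real m * s) / ?lam)\<^sup>2"
    by (rule power_mono) simp
  also have "\<dots> = ?D\<^sup>2 * ((real n)\<^sup>2 / (real m)\<^sup>2) * (real m * s) / ?lam\<^sup>2"
    using \<open>s \<ge> 0\<close> by (simp add: power_mult_distrib power_divide)
  also have "\<dots> = real n * (?D\<^sup>2 * (real n * s / ?lam\<^sup>2) * (1 / real m))"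
    by (simp add: power2_eq_square mult_ac)
  finally show ?thesis unfolding MSE_eq_L2_set by (cases "n = 0") (simp_all add: field_simps)
qed

theorem theorem2:
  fixes n m k :: nat and b :: real and S :: "nat \<Rightarrow> nat set" and \<theta>s :: "nat \<Rightarrow> real"
  assumes theta_star: "\<theta>s \<in> Theta n b"
    and sets: "\<And>t. t < m \<Longrightarrow> S t \<subseteq> {..<n} \<and> card (S t) = k"
    and k2: "k \<ge> 2"
    and lam: "lambda2 (laplacian (cooc_mat n m S)) > 0"
  shows "measure_pmf.prob (choices_pmf \<theta>s m S)
     {y. \<forall>\<theta>h \<in> Theta n b. (\<forall>\<theta>\<in>Theta n b. loglik m S y \<theta> \<le> loglik m S y \<theta>h) \<longrightarrow>
          MSE n \<theta>h \<theta>s \<le> (4 * real k ^ 2 * exp (4 * b))\<^sup>2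
             * (real n * (ln (real n) + 2) / (lambda2 (laplacian (cooc_mat n m S)))\<^sup>2)
             * (1 / real m)}
     \<ge> 1 - 2 / real n" (is "measure_pmf.prob ?P ?good \<ge> _")
proof (cases "n = 0")
  case True
  then have "?good = UNIV" by (simp add: MSE_def)
  then show ?thesis by simp
next
  case False
  define s where "s = ln (real n) + 2"
  let ?bad = "{y. L2_set (loglik_score m S y \<theta>s) {..<n} > 2 * sqrt (real m * s)}"
  have "s \<ge> 0" using False by (simp add: s_def)
  have nonempty: "S t \<noteq> {}" if "t < m" for t using sets[OF that] k2 by auto
  have "measure_pmf.prob ?P ?bad \<le> 2 * exp (- s)"
    using sets nonempty \<open>s \<ge> 0\<close> by (intro prob_loglik_score_gt_le) auto
  also have "\<dots> \<le> 2 * exp (- ln (real n))" by (simp add: s_def)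
  also have "\<dots> = 2 / real n" using False by (simp add: exp_minus divide_inverse)
  finally have "1 - 2 / real n \<le> 1 - measure_pmf.prob ?P ?bad" by simp
  also have "\<dots> = measure_pmf.prob ?P (- ?bad)"
    using measure_pmf.prob_compl[of ?bad ?P] by (simp add: Compl_eq_Diff_UNIV)
  also have "\<dots> \<le> measure_pmf.prob ?P ?good"
    using theta_star sets nonempty k2 lam \<open>s \<ge> 0\<close>
    by (intro measure_pmf.finite_measure_mono subsetI CollectI ballI impI
        MSE_le_of_loglik_score_le[where s = "ln (real n) + 2"]) (auto simp: s_def not_less)
  finally show ?thesis .
qed

end
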